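(* Let $T$ be a (combed) tree with nodes $N_1,\dots,N_k$, where $N_i$ has $m_i$ inputs, and let $l=\left(\sum_{i=1}^k m_i\right)-k+1$. Then the graph $\xi_T:X_{m_1}\otimes\cdots\otimes X_{m_k}\to X_l$ in $K\mathbf{1}$ representing $T$ is allowable.
   Context: **Shapes.** Shapes are formal objects generated by: $I$ and $1$ are shapes; if $S,T$ are shapes so are $S\otimes T$ and $[S,T]$. We work strictly: $(T\otimes S)\otimes R=T\otimes(S\otimes R)$, $T\otimes I=T=I\otimes T$. Each shape $T$ has a list $v(T)$ of signs (its variables with their variances): $v(I)=\emptyset$, $v(1)=\{+\}$, $v(T\otimes S)=v(T)\sqcup v(S)$, $v([T,S])=v(T)^{\mathrm{op}}\sqcup v(S)$, where $\sqcup$ is concatenation and $(-)^{\mathrm{op}}$ reverses all signs. **Graphs.** A (Kelly–Mac Lane) graph $T\to S$ is a fixed-point-free pairing of the variables of $T$ and $S$ such that paired elements ("mates") have opposite variances in $v(T)^{\mathrm{op}}\sqcup v(S)$. Graphs $f:T\to S$, $g:S\to R$ compose to $gf:T\to R$ by gluing along the variables of $S$ and following paths (closed loops arising among the variables of $S$ are discarded). $K\mathbf{1}$ is the category of shapes and graphs. For $f:T\to T'$, $g:S\to S'$, both $f\otimes g:T\otimes S\to T'\otimes S'$ and $[f,g]:[T',S]\to[T,S']$ are given by the disjoint union of the pairings of $f$ and $g$. **Allowable morphisms.** The smallest class of morphisms of $K\mathbf{1}$ that contains, for all shapes $T,S$: the identities; $c:T\otimes S\to S\otimes T$ (pairing the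 two copies of $T$ variable by variable, and likewise the two copies of $S$); $d:T\to[S,T\otimes S]$ (pairing the two copies of $T$, and the two copies of $S$ in the codomain); $e:[T,S]\otimes T\to S$ (pairing the two copies of $T$ in the domain, and the two copies of $S$); and that is closed under $f\otimes g$, $[f,g]$ and composition. (The associativity and unit constraints are identities in the strict setting.) **Notation.** $X_m=[1^{\otimes m},1]$ for $m\ge 0$, with $1^{\otimes 0}=I$; an empty tensor product of $X$'s is $I$. **Trees.** A planar tree is (inductively) either the null tree (a single edge with no nodes, which is both its only leaf and its root), or a root node having $n\ge 0$ ordered inputs and one output (the root of the tree), with a planar tree attached by its root to each input. Its leaves are the edges not attached to the output of any node (a node may have $0$ inputs), ordered left to right. A tree (combed tree with ordered nodes) is a triple $(T,\rho,\tau)$ with $T$ a planar tree with $k$ nodes and $l$ leaves, $\rho\in S_l$ a permutation, and $\tau$ a bijection from the nodes to $\{1,\dots,k\}$. Write $N_i=\tau^{-1}(i)$, and call the leaf in planar position $i$ the $\rho(i)$-th leaf of the tree. If $N_i$ has $m_i$ inputs then the number of leaves is $l=\sum_i m_i-k+1$. **The graph $\xi_T$.** Write $X_{m_i}=[A_{i1}\otimes\cdots\otimes A_{im_i},A_i]$ and $X_l=[B_1\otimes\cdots\otimes B_l,B]$, with all $A_{ij},A_i,B_p,B$ equal to $1$. In $\xi_T$: $A_{ij}$ is the mate of $A_r$ if the $j$th input of $N_i$ is joined to the output of $N_r$; $A_{ij}$ is the mate of $B_p$ if the $j$th input of $N_i$ is the $p$th leaf of $T$; $A_r$ is the mate of $B$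 if the output of $N_r$ is the root of $T$. For the null tree ($k=0$, $l=1$), $B_1$ is the mate of $B$. *)

theory Defs
  imports Main "HOL-Combinatorics.Permutations"
begin

section \<open>Shapes\<close>

text \<open>
  Because the tensor product is strictly associative and unital, a shape is the same thing as a
  finite list of tensor-indecomposable shapes (a free monoid on these): the tensor product is
  concatenation and the unit is the empty list.  No other identification is made; in particular
  \<^term>\<open>[Hom [] S]\<close> and \<^term>\<open>S\<close> are different shapes.
\<close>

datatype factor = One | Hom "factor list" "factor list"

type_synonym shape = "factor list"

definition unit_shape :: shape where
  "unit_shape = []"

definition one_shape :: shape where
  "one_shape = [One]"

definition tensor :: "shape \<Rightarrow> shape \<Rightarrow> shape" (infixr "\<otimes>\<^sub>s" 70) where
  "S \<otimes>\<^sub>s T = S @ T"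

definition hom_shape :: "shape \<Rightarrow> shape \<Rightarrow> shape" where
  "hom_shape S T = [Hom S T]"

lemma tensor_assoc: "(T \<otimes>\<^sub>s S) \<otimes>\<^sub>s R = T \<otimes>\<^sub>s (S \<otimes>\<^sub>s R)"
  and tensor_unit_left: "unit_shape \<otimes>\<^sub>s T = T"
  and tensor_unit_right: "T \<otimes>\<^sub>s unit_shape = T"
  by (simp_all add: tensor_def unit_shape_def)

definition tensor_list :: "shape list \<Rightarrow> shape" where
  "tensor_list Ss = foldr (\<otimes>\<^sub>s) Ss unit_shape"

definition X :: "nat \<Rightarrow> shape" where
  "X m = hom_shape (tensor_list (replicate m one_shape)) one_shape"

datatype sign = Plus | Minus

primrec opp :: "sign \<Rightarrow> sign" where
  "opp Plus = Minus"
| "opp Minus = Plus"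

primrec factor_vars :: "factor \<Rightarrow> sign list" where
  "factor_vars One = [Plus]"
| "factor_vars (Hom S T) =
     map opp (concat (map factor_vars S)) @ concat (map factor_vars T)"

definition vars :: "shape \<Rightarrow> sign list" where
  "vars S = concat (map factor_vars S)"

lemma vars_unit_shape: "vars unit_shape = []"
  and vars_one_shape: "vars one_shape = [Plus]"
  and vars_tensor: "vars (T \<otimes>\<^sub>s S) = vars T @ vars S"
  and vars_hom_shape: "vars (hom_shape T S) = map opp (vars T) @ vars S"
  by (simp_all add: vars_def unit_shape_def one_shape_def tensor_def hom_shape_def)

abbreviation nvars :: "shape \<Rightarrow> nat" where
  "nvars S \<equiv> length (vars S)"


section \<open>Graphs\<close>

text \<open>
  Variables are numbered from 0.  For a graph from \<open>T\<close> to \<open>S\<close>, \<^term>\<open>Inl i\<close> is the \<open>i\<close>-th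
  variable of \<open>T\<close> and \<^term>\<open>Inr j\<close> the \<open>j\<close>-th variable of \<open>S\<close>.  A pairing is given by the
  (symmetric) relation of being mates.
\<close>

type_synonym pairing = "(nat + nat) rel"

definition graph_vars :: "shape \<Rightarrow> shape \<Rightarrow> (nat + nat) set" where
  "graph_vars T S = {..<nvars T} <+> {..<nvars S}"

definition variance :: "shape \<Rightarrow> shape \<Rightarrow> nat + nat \<Rightarrow> sign" where
  "variance T S x = (case x of Inl i \<Rightarrow> opp (vars T ! i) | Inr j \<Rightarrow> vars S ! j)"

definition graph :: "shape \<Rightarrow> shape \<Rightarrow> pairing \<Rightarrow> bool" where
  "graph T S f \<longleftrightarrow>
     f \<subseteq> graph_vars T S \<times> graph_vars T S \<and> sym f \<and> irrefl f \<and>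
     (\<forall>x \<in> graph_vars T S. \<exists>!y. (x, y) \<in> f) \<and>
     (\<forall>x y. (x, y) \<in> f \<longrightarrow> variance T S x = opp (variance T S y))"

definition sym_closure :: "'a rel \<Rightarrow> 'a rel" where
  "sym_closure r = r \<union> r\<inverse>"

definition relabel :: "('a \<Rightarrow> 'b) \<Rightarrow> 'a rel \<Rightarrow> 'b rel" where
  "relabel h r = {(h x, h y) | x y. (x, y) \<in> r}"

text \<open>
  For the composite of \<open>f : T \<rightarrow> S\<close> and \<open>g : S \<rightarrow> R\<close>, the two pairings are glued along \<open>S\<close>: the
  variables of \<open>T\<close>, \<open>S\<close>, \<open>R\<close> become \<open>Dom\<close>, \<open>Mid\<close>, \<open>Cod\<close>.  In the glued graph the outer variables
  have degree 1 and those of \<open>S\<close> degree 2, so distinct outer variables are connected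
  precisely when they are the two ends of a path; closed loops never involve outer variables.
\<close>

datatype glued = Dom nat | Mid nat | Cod nat

definition compose :: "pairing \<Rightarrow> pairing \<Rightarrow> pairing" where
  "compose g f =
     {(x, y). x \<noteq> y \<and>
        (case_sum Dom Cod x, case_sum Dom Cod y)
          \<in> (relabel (case_sum Dom Mid) f \<union> relabel (case_sum Mid Cod) g)\<^sup>*}"

definition id_graph :: "shape \<Rightarrow> pairing" where
  "id_graph T = sym_closure {(Inl i, Inr i) | i. i < nvars T}"

definition c_graph :: "shape \<Rightarrow> shape \<Rightarrow> pairing" where
  "c_graph T S = sym_closure
     ({(Inl i, Inr (nvars S + i)) | i. i < nvars T} \<union>
      {(Inl (nvars T + j), Inr j) | j. j < nvars S})"

definition d_graph :: "shape \<Rightarrow> shape \<Rightarrow> pairing" where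
  "d_graph T S = sym_closure
     ({(Inl i, Inr (nvars S + i)) | i. i < nvars T} \<union>
      {(Inr j, Inr (nvars S + nvars T + j)) | j. j < nvars S})"

definition e_graph :: "shape \<Rightarrow> shape \<Rightarrow> pairing" where
  "e_graph T S = sym_closure
     ({(Inl i, Inl (nvars T + nvars S + i)) | i. i < nvars T} \<union>
      {(Inl (nvars T + j), Inr j) | j. j < nvars S})"

text \<open>\<open>f : T \<rightarrow> T'\<close> and \<open>g\<close> are placed side by side, the variables of \<open>g\<close> coming after those of \<open>f\<close>.\<close>

definition tensor_graph :: "shape \<Rightarrow> shape \<Rightarrow> pairing \<Rightarrow> pairing \<Rightarrow> pairing" where
  "tensor_graph T T' f g =
     f \<union> relabel (map_sum (\<lambda>i. nvars T + i) (\<lambda>j. nvars T' + j)) g"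

text \<open>
  For \<open>f : T \<rightarrow> T'\<close> and \<open>g : S \<rightarrow> S'\<close>, a graph from \<open>[T', S]\<close> to \<open>[T, S']\<close>: domain and codomain
  of \<open>f\<close> are exchanged.
\<close>

definition hom_graph :: "shape \<Rightarrow> shape \<Rightarrow> pairing \<Rightarrow> pairing \<Rightarrow> pairing" where
  "hom_graph T T' f g =
     relabel (case_sum Inr Inl) f \<union>
     relabel (map_sum (\<lambda>i. nvars T' + i) (\<lambda>j. nvars T + j)) g"

inductive allowable :: "shape \<Rightarrow> shape \<Rightarrow> pairing \<Rightarrow> bool" where
  allowable_id: "allowable T T (id_graph T)"
| allowable_c: "allowable (T \<otimes>\<^sub>s S) (S \<otimes>\<^sub>s T) (c_graph T S)"
| allowable_d: "allowable T (hom_shape S (T \<otimes>\<^sub>s S)) (d_graph T S)"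
| allowable_e: "allowable (hom_shape T S \<otimes>\<^sub>s T) S (e_graph T S)"
| allowable_tensor: "allowable T T' f \<Longrightarrow> allowable S S' g \<Longrightarrow>
    allowable (T \<otimes>\<^sub>s S) (T' \<otimes>\<^sub>s S') (tensor_graph T T' f g)"
| allowable_hom: "allowable T T' f \<Longrightarrow> allowable S S' g \<Longrightarrow>
    allowable (hom_shape T' S) (hom_shape T S') (hom_graph T T' f g)"
| allowable_comp: "allowable T S f \<Longrightarrow> allowable S R g \<Longrightarrow>
    allowable T R (compose g f)"


section \<open>Trees\<close>

datatype ptree = Null | Node "ptree list"

text \<open>
  Edges are addressed by the list of input numbers (from 0) leading to them from the root edge
  \<open>[]\<close>; a node has the address of its output edge.  So the \<open>j\<close>-th input of the node at \<open>p\<close> is the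
  edge \<open>p @ [j]\<close>.  Both lists below are in left-to-right (depth-first) order.
\<close>

definition graft_addrs :: "nat list list list \<Rightarrow> nat list list" where
  "graft_addrs pss = concat (map (\<lambda>(j, ps). map ((#) j) ps) (enumerate 0 pss))"

primrec leaves :: "ptree \<Rightarrow> nat list list" where
  "leaves Null = [[]]"
| "leaves (Node ts) = graft_addrs (map leaves ts)"

primrec nodes :: "ptree \<Rightarrow> nat list list" where
  "nodes Null = []"
| "nodes (Node ts) = [] # graft_addrs (map nodes ts)"

fun num_inputs :: "ptree \<Rightarrow> nat list \<Rightarrow> nat" where
  "num_inputs (Node ts) [] = length ts"
| "num_inputs (Node ts) (j # p) = num_inputs (ts ! j) p"
| "num_inputs Null p = 0"

text \<open>Leaf and node numbers start at 0, so \<open>\<rho>\<close> and \<open>\<tau>\<close> take values in \<open>{..<l}\<close> and \<open>{..<k}\<close>.\<close>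

definition combed_tree :: "ptree \<Rightarrow> (nat \<Rightarrow> nat) \<Rightarrow> (nat list \<Rightarrow> nat) \<Rightarrow> bool" where
  "combed_tree T \<rho> \<tau> \<longleftrightarrow>
     \<rho> permutes {..<length (leaves T)} \<and>
     bij_betw \<tau> (set (nodes T)) {..<length (nodes T)}"

definition nth_node :: "ptree \<Rightarrow> (nat list \<Rightarrow> nat) \<Rightarrow> nat \<Rightarrow> nat list" where
  "nth_node T \<tau> i = inv_into (set (nodes T)) \<tau> i"

definition node_inputs :: "ptree \<Rightarrow> (nat list \<Rightarrow> nat) \<Rightarrow> nat \<Rightarrow> nat" where
  "node_inputs T \<tau> i = num_inputs T (nth_node T \<tau> i)"

definition nth_leaf :: "ptree \<Rightarrow> (nat \<Rightarrow> nat) \<Rightarrow> nat \<Rightarrow> nat list" where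
  "nth_leaf T \<rho> p = leaves T ! inv \<rho> p"


section \<open>The graph of a tree\<close>

text \<open>
  The variables \<open>A\<^sub>i\<^sub>j\<close>, \<open>A\<^sub>i\<close> of the domain, the tensor product of the shapes \<open>X (m r)\<close>, each of which
  has \<open>m r + 1\<close> variables, and the variables \<open>B\<^sub>p\<close>, \<open>B\<close> of the codomain \<open>X l\<close>.
\<close>

definition A_in :: "(nat \<Rightarrow> nat) \<Rightarrow> nat \<Rightarrow> nat \<Rightarrow> nat + nat" where
  "A_in m i j = Inl ((\<Sum>r<i. (m r + 1)) + j)"

definition A_out :: "(nat \<Rightarrow> nat) \<Rightarrow> nat \<Rightarrow> nat + nat" where
  "A_out m i = Inl ((\<Sum>r<i. (m r + 1)) + m i)"

definition B_in :: "nat \<Rightarrow> nat + nat" where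
  "B_in p = Inr p"

definition B_out :: "nat \<Rightarrow> nat + nat" where
  "B_out l = Inr l"

definition xi :: "ptree \<Rightarrow> (nat \<Rightarrow> nat) \<Rightarrow> (nat list \<Rightarrow> nat) \<Rightarrow> pairing" where
  "xi T \<rho> \<tau> =
     (let k = length (nodes T); l = length (leaves T);
          m = node_inputs T \<tau>; N = nth_node T \<tau>
      in sym_closure
        ({(A_in m i j, A_out m r) | i j r. i < k \<and> j < m i \<and> r < k \<and> N i @ [j] = N r} \<union>
         {(A_in m i j, B_in p) | i j p. i < k \<and> j < m i \<and> p < l \<and> N i @ [j] = nth_leaf T \<rho> p} \<union>
         {(A_out m r, B_out l) | r. r < k \<and> N r = []} \<union>
         (if T = Null then {(B_in 0, B_out l)} else {})))"

end

theory Submission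
  imports Defs
begin

text \<open>
  The idea is to label variables instead of following paths.  Give every variable occurring in
  \<open>\<xi>\<^sub>T\<close> the edge of \<open>T\<close> that it stands for: the \<open>j\<close>-th input of a node, the output of a node, a leaf
  or the root.  Two distinct variables are mates in \<open>\<xi>\<^sub>T\<close> exactly when they carry the same edge, and every
  edge is carried by two variables of opposite variance.  Consequently an allowable graph with the
  right domain and codomain, all of whose mates carry equal labels, can only be \<open>\<xi>\<^sub>T\<close>
  (\<open>graph_eq_xi\<close>), and it suffices to find such a graph.

  Write \<open>L \<leadsto> M\<close> if there is an allowable, label-preserving graph between the labelled shapes \<open>L\<close>
  and \<open>M\<close>.  This relation is closed under all the constructions of allowable morphisms.  In
  particular it is transitive, because a path in the glued graph never changes the label; no path
  has to be computed.  It can therefore be used like provability in the logic of tensor and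
  internal hom, with labels as atoms: a node with inputs \<open>a\<^sub>1, \<dots>, a\<^sub>n\<close> and output \<open>a\<close> is the
  formula \<open>[a\<^sub>1 \<otimes> \<dots> \<otimes> a\<^sub>n, a]\<close>.  By induction on the tree, evaluating each node
  on the outputs of the subtrees above it, all nodes together with all leaves yield the root
  (\<open>label_allowable_tree\<close>).  Symmetries bring nodes and leaves into the prescribed order, and
  transposing the leaves to the right-hand side shows that the nodes yield \<open>[b\<^sub>1 \<otimes> \<dots> \<otimes> b\<^sub>l, b]\<close>.

  The uniqueness argument needs that an allowable morphism really is a graph
  (\<open>graph_allowable\<close>), hence that graphs compose.  Variances settle this: directing every edge
  of the glued graph from one sign to the other makes every inner variable have one incoming and
  one outgoing edge, so that following a path is iterating a finite partial injection.
\<close>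


section \<open>Allowable morphisms are graphs\<close>

lemma opp_opp [simp]: "opp (opp s) = s"
  by (cases s) auto

lemma opp_neq [simp]: "opp s \<noteq> s" "s \<noteq> opp s"
  by (cases s; simp)+

lemma opp_inject [simp]: "opp s = opp t \<longleftrightarrow> s = t"
  by (cases s; cases t; simp)

lemma neq_opp_iff: "s \<noteq> t \<longleftrightarrow> s = opp t"
  by (cases s; cases t; simp)

lemma lessThan_add: "{..<a + b} = {..<a} \<union> (\<lambda>i. a + i) ` {..<b::nat}"
proof -
  have "n \<in> (\<lambda>i. a + i) ` {..<b}" if "n < a + b" "\<not> n < a" for n
    using that by (intro image_eqI[of _ _ "n - a"]) auto
  then show ?thesis by auto
qed

lemma graphI:
  assumes sub: "f \<subseteq> graph_vars T S \<times> graph_vars T S" and sym: "sym f" and sv: "single_valued f"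
    and total: "\<And>x. x \<in> graph_vars T S \<Longrightarrow> \<exists>y. (x, y) \<in> f"
    and var: "\<And>x y. (x, y) \<in> f \<Longrightarrow> variance T S x = opp (variance T S y)"
  shows "graph T S f"
  unfolding graph_def
proof (intro conjI ballI allI impI sub sym var)
  show "irrefl f" using var by (fastforce simp: irrefl_def)
  show "\<exists>!y. (x, y) \<in> f" if "x \<in> graph_vars T S" for x
    using total[OF that] sv by (auto simp: single_valued_def)
qed

lemma
  assumes "graph T S f"
  shows graph_sub: "f \<subseteq> graph_vars T S \<times> graph_vars T S"
    and graph_sym: "sym f"
    and graph_total: "x \<in> graph_vars T S \<Longrightarrow> \<exists>y. (x, y) \<in> f"
    and graph_single_valued: "single_valued f"
    and graph_opposite: "(x, y) \<in> f \<Longrightarrow> variance T S x = opp (variance T S y)"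
proof -
  have *: "f \<subseteq> graph_vars T S \<times> graph_vars T S" "sym f"
    "\<forall>x \<in> graph_vars T S. \<exists>!y. (x, y) \<in> f"
    "\<forall>x y. (x, y) \<in> f \<longrightarrow> variance T S x = opp (variance T S y)"
    using assms by (simp_all add: graph_def)
  show "f \<subseteq> graph_vars T S \<times> graph_vars T S" "sym f" by fact+
  show "single_valued f"
    using *(1,3) by (blast intro: single_valuedI)
  show "\<exists>y. (x, y) \<in> f" if "x \<in> graph_vars T S" using *(3) that by blast
  show "variance T S x = opp (variance T S y)" if "(x, y) \<in> f" using *(4) that by blast
qed

lemma single_valued_Un:
  assumes "single_valued r" "single_valued s" "Domain r \<inter> Domain s = {}"
  shows "single_valued (r \<union> s)"
  using assms unfolding single_valued_def by blast

lemma graph_sym_closureI: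
  assumes cover: "Domain r \<union> Range r = graph_vars T S" and disj: "Domain r \<inter> Range r = {}"
    and sv: "single_valued r" "single_valued (r\<inverse>)"
    and var: "\<And>x y. (x, y) \<in> r \<Longrightarrow> variance T S x = opp (variance T S y)"
  shows "graph T S (sym_closure r)"
proof (rule graphI)
  show "sym_closure r \<subseteq> graph_vars T S \<times> graph_vars T S"
    unfolding cover[symmetric] by (auto simp: sym_closure_def)
  show "sym (sym_closure r)"
    by (auto simp: sym_closure_def sym_def)
  show "single_valued (sym_closure r)"
    unfolding sym_closure_def using sv disj by (intro single_valued_Un) auto
  show "\<exists>y. (x, y) \<in> sym_closure r" if "x \<in> graph_vars T S" for x
    using that unfolding cover[symmetric] by (auto simp: sym_closure_def)
  show "variance T S x = opp (variance T S y)" if "(x, y) \<in> sym_closure r" for x y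
    using that var by (auto simp: sym_closure_def)
qed

lemma relabelI: "(x, y) \<in> r \<Longrightarrow> (h x, h y) \<in> relabel h r"
  by (auto simp: relabel_def)

lemma relabelE:
  assumes "(u, v) \<in> relabel h r"
  obtains x y where "u = h x" "v = h y" "(x, y) \<in> r"
  using assms by (auto simp: relabel_def)

lemma sym_relabel: "sym r \<Longrightarrow> sym (relabel h r)"
  by (auto simp: relabel_def sym_def)

lemma single_valued_relabel: "inj h \<Longrightarrow> single_valued r \<Longrightarrow> single_valued (relabel h r)"
  by (auto simp: relabel_def single_valued_def dest: injD)

lemma graph_id: "graph T T (id_graph T)"
  unfolding id_graph_def
  by (rule graph_sym_closureI)
    (auto simp: graph_vars_def variance_def single_valued_def Plus_def)

lemma graph_c: "graph (T \<otimes>\<^sub>s S) (S \<otimes>\<^sub>s T) (c_graph T S)"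
  unfolding c_graph_def
  by (rule graph_sym_closureI)
    (auto simp: graph_vars_def variance_def single_valued_def Plus_def vars_tensor lessThan_add
      nth_append)

lemma graph_d: "graph T (hom_shape S (T \<otimes>\<^sub>s S)) (d_graph T S)"
  unfolding d_graph_def
  by (rule graph_sym_closureI)
    (auto simp: graph_vars_def variance_def single_valued_def Plus_def vars_tensor vars_hom_shape
      lessThan_add nth_append)

lemma graph_e: "graph (hom_shape T S \<otimes>\<^sub>s T) S (e_graph T S)"
  unfolding e_graph_def
  by (rule graph_sym_closureI)
    (auto simp: graph_vars_def variance_def single_valued_def Plus_def vars_tensor vars_hom_shape
      lessThan_add nth_append)

text \<open>
  The tensor product and the internal hom of graphs are both disjoint unions of two pairings, moved
  by injections that respect variance, so one argument covers the two.
\<close>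

lemma graph_relabel_Un:
  assumes f: "graph T T' f" and g: "graph S S' g"
    and inj: "inj p" "inj q"
    and cover: "p ` graph_vars T T' \<union> q ` graph_vars S S' = graph_vars R R'"
    and disj: "p ` graph_vars T T' \<inter> q ` graph_vars S S' = {}"
    and var_p: "\<And>x. x \<in> graph_vars T T' \<Longrightarrow> variance R R' (p x) = variance T T' x"
    and var_q: "\<And>x. x \<in> graph_vars S S' \<Longrightarrow> variance R R' (q x) = variance S S' x"
  shows "graph R R' (relabel p f \<union> relabel q g)"
proof (rule graphI)
  have fsub: "relabel p f \<subseteq> p ` graph_vars T T' \<times> p ` graph_vars T T'"
    using graph_sub[OF f] by (auto elim!: relabelE)
  have gsub: "relabel q g \<subseteq> q ` graph_vars S S' \<times> q ` graph_vars S S'"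
    using graph_sub[OF g] by (auto elim!: relabelE)
  show "relabel p f \<union> relabel q g \<subseteq> graph_vars R R' \<times> graph_vars R R'"
    unfolding cover[symmetric] using fsub gsub by blast
  show "sym (relabel p f \<union> relabel q g)"
    using f g by (intro sym_Un sym_relabel graph_sym)
  show "single_valued (relabel p f \<union> relabel q g)"
  proof (intro single_valued_Un single_valued_relabel inj)
    show "Domain (relabel p f) \<inter> Domain (relabel q g) = {}"
      using fsub gsub disj by blast
  qed (use f g graph_single_valued in auto)
  show "\<exists>y. (x, y) \<in> relabel p f \<union> relabel q g" if "x \<in> graph_vars R R'" for x
    using that graph_total[OF f] graph_total[OF g] unfolding cover[symmetric]
    by (blast intro: relabelI)
  fix x y assume "(x, y) \<in> relabel p f \<union> relabel q g"
  then show "variance R R' x = opp (variance R R' y)"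
  proof
    assume "(x, y) \<in> relabel p f"
    then obtain a b where "x = p a" "y = p b" "(a, b) \<in> f" by (rule relabelE)
    moreover from this have "a \<in> graph_vars T T'" "b \<in> graph_vars T T'"
      using graph_sub[OF f] by auto
    ultimately show ?thesis using graph_opposite[OF f] var_p by simp
  next
    assume "(x, y) \<in> relabel q g"
    then obtain a b where "x = q a" "y = q b" "(a, b) \<in> g" by (rule relabelE)
    moreover from this have "a \<in> graph_vars S S'" "b \<in> graph_vars S S'"
      using graph_sub[OF g] by auto
    ultimately show ?thesis using graph_opposite[OF g] var_q by simp
  qed
qed

lemma relabel_id: "relabel (\<lambda>x. x) f = f"
  by (auto simp: relabel_def)

lemma graph_tensor:
  assumes "graph T T' f" "graph S S' g"
  shows "graph (T \<otimes>\<^sub>s S) (T' \<otimes>\<^sub>s S') (tensor_graph T T' f g)"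
proof -
  have "graph (T \<otimes>\<^sub>s S) (T' \<otimes>\<^sub>s S')
    (relabel (\<lambda>x. x) f \<union> relabel (map_sum (\<lambda>i. nvars T + i) (\<lambda>j. nvars T' + j)) g)"
    by (rule graph_relabel_Un[OF assms])
      (auto simp: graph_vars_def variance_def Plus_def vars_tensor lessThan_add nth_append
        image_Un image_image intro!: sum.inj_map split: sum.splits)
  then show ?thesis by (simp add: tensor_graph_def relabel_id)
qed

lemma graph_hom:
  assumes "graph T T' f" "graph S S' g"
  shows "graph (hom_shape T' S) (hom_shape T S') (hom_graph T T' f g)"
proof -
  have "inj (case_sum Inr Inl :: nat + nat \<Rightarrow> nat + nat)"
    by (auto simp: inj_def split: sum.splits)
  moreover have "inj (map_sum (\<lambda>i. nvars T' + i) (\<lambda>j. nvars T + j))"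
    by (intro sum.inj_map) auto
  ultimately show ?thesis
    unfolding hom_graph_def
    by (intro graph_relabel_Un[OF assms])
      (auto simp: graph_vars_def variance_def Plus_def vars_hom_shape lessThan_add nth_append
        image_Un image_image)
qed

text \<open>
  In a partial injection a zigzag cannot turn around: a step forward followed by a step
  backward returns to the start.  Undirected connectedness is therefore directed reachability in
  one of the two directions.
\<close>

lemma rtrancl_Un_converse:
  assumes "single_valued r" "single_valued (r\<inverse>)"
  shows "(r \<union> r\<inverse>)\<^sup>* = r\<^sup>* \<union> (r\<inverse>)\<^sup>*"
proof
  have "(x, y) \<in> r\<^sup>* \<union> (r\<inverse>)\<^sup>*" if "(x, y) \<in> (r \<union> r\<inverse>)\<^sup>*" for x y
    using that
  proof (induction rule: rtrancl_induct)
    case (step y z)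
    have a: "(x, z) \<in> r\<^sup>* \<union> (r\<inverse>)\<^sup>*" if "(x, y) \<in> s\<^sup>*" "(z, y) \<in> s" "single_valued (s\<inverse>)"
      "s = r \<or> s = r\<inverse>" for s
      using that(1)
    proof (cases rule: rtranclE)
      case base
      then show ?thesis using that by auto
    next
      case (step w)
      then have "w = z" using that(2,3) by (auto simp: single_valued_def)
      then show ?thesis using step that(4) by auto
    qed
    show ?case
      using step a[of r] a[of "r\<inverse>"] assms by (auto intro: rtrancl_into_rtrancl)
  qed simp
  then show "(r \<union> r\<inverse>)\<^sup>* \<subseteq> r\<^sup>* \<union> (r\<inverse>)\<^sup>*" by auto
  show "r\<^sup>* \<union> (r\<inverse>)\<^sup>* \<subseteq> (r \<union> r\<inverse>)\<^sup>*"
    by (simp add: rtrancl_mono)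
qed

text \<open>
  If the orbit of \<open>x\<close> never left the domain, the relation would restrict to an injective, hence
  surjective, self-map of this finite orbit, and \<open>x\<close> would have a predecessor.
\<close>

lemma finite_orbit_leaves_Domain:
  assumes "finite r" "single_valued r" "single_valued (r\<inverse>)" "x \<notin> Range r"
  shows "\<exists>y. (x, y) \<in> r\<^sup>* \<and> y \<notin> Domain r"
proof (rule ccontr)
  assume none: "\<not> ?thesis"
  define C where "C = r\<^sup>* `` {x}"
  have "C \<subseteq> insert x (Range r)"
    by (auto simp: C_def elim: rtranclE)
  then have fin: "finite C"
    using assms(1) by (meson finite.insertI finite_Range finite_subset)
  \<comment> \<open>the successor map of the relation, total on the orbit \<open>C\<close>\<close>
  define n where "n = (\<lambda>y. SOME z. (y, z) \<in> r)"
  have n: "(y, n y) \<in> r" if "y \<in> C" for y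
    using that none unfolding n_def C_def by (auto intro: someI)
  have "n ` C \<subseteq> C"
    using n by (auto simp: C_def intro: rtrancl_into_rtrancl)
  moreover have "inj_on n C"
    using n assms(3) by (auto simp: inj_on_def single_valued_def) metis
  ultimately have "n ` C = C"
    using fin by (simp add: endo_inj_surj)
  moreover have "x \<in> C" by (simp add: C_def)
  ultimately have "x \<in> n ` C" by simp
  then show False using n assms(4) by auto
qed

lemma rtrancl_in_Range: "(x, y) \<in> r\<^sup>* \<Longrightarrow> x \<noteq> y \<Longrightarrow> y \<in> Range r"
  by (auto elim: rtranclE)

abbreviation outer :: "nat + nat \<Rightarrow> glued" where
  "outer \<equiv> case_sum Dom Cod"

text \<open>
  The edges of the glued graph directed away from their end of variance \<open>s\<close>, the variance being
  taken in the pairing that the edge comes from.  A variable of the middle shape \<open>S\<close> has opposite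
  variances in \<open>f\<close> and in \<open>g\<close>, so exactly one of its two edges leaves it.  The sign is a parameter
  because reversing all edges is the same as passing to the opposite sign.
\<close>

definition oriented :: "shape \<Rightarrow> shape \<Rightarrow> shape \<Rightarrow> pairing \<Rightarrow> pairing \<Rightarrow> sign \<Rightarrow> glued rel" where
  "oriented T S R f g s =
     relabel (case_sum Dom Mid) {(x, y) \<in> f. variance T S x = s} \<union>
     relabel (case_sum Mid Cod) {(x, y) \<in> g. variance S R x = s}"

context
  fixes T S R f g
  assumes f: "graph T S f" and g: "graph S R g"
begin

lemma oriented_Un:
  "relabel (case_sum Dom Mid) f \<union> relabel (case_sum Mid Cod) g =
    oriented T S R f g s \<union> oriented T S R f g (opp s)"
proof -
  have split: "relabel k h = relabel k {(x, y) \<in> h. v x = s} \<union> relabel k {(x, y) \<in> h. v x = opp s}"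
    for k :: "nat + nat \<Rightarrow> glued" and h v
  proof -
    have "h = {(x, y) \<in> h. v x = s} \<union> {(x, y) \<in> h. v x = opp s}"
      using neq_opp_iff by blast
    moreover have "relabel k (h' \<union> h'') = relabel k h' \<union> relabel k h''" for h' h''
      by (auto simp: relabel_def)
    ultimately show ?thesis by metis
  qed
  show ?thesis
    unfolding oriented_def split[of "case_sum Dom Mid" f "variance T S"]
      split[of "case_sum Mid Cod" g "variance S R"]
    by (simp only: Un_ac)
qed

lemma converse_oriented: "(oriented T S R f g s)\<inverse> = oriented T S R f g (opp s)"
proof -
  have flip: "{(x, y) \<in> h. variance U V x = s}\<inverse> = {(x, y) \<in> h. variance U V x = opp s}"
    if h: "graph U V h" for U V h
  proof -
    have sub: "{(x, y) \<in> h. variance U V x = t}\<inverse> \<subseteq> {(x, y) \<in> h. variance U V x = opp t}" for t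
    proof (rule subrelI)
      fix x y assume "(x, y) \<in> {(x, y) \<in> h. variance U V x = t}\<inverse>"
      then have yx: "(y, x) \<in> h" "variance U V y = t" by auto
      then have "(x, y) \<in> h" using symD[OF graph_sym[OF h]] by blast
      then show "(x, y) \<in> {(x, y) \<in> h. variance U V x = opp t}"
        using graph_opposite[OF h, of x y] yx by simp
    qed
    show ?thesis
      using sub[of s] sub[of "opp s"] by (simp only: opp_opp) blast
  qed
  have "(relabel k h)\<inverse> = relabel k (h\<inverse>)" for k :: "nat + nat \<Rightarrow> glued" and h
    by (auto simp: relabel_def)
  then show ?thesis
    unfolding oriented_def converse_Un by (simp only: flip[OF f] flip[OF g])
qed

lemma Range_oriented: "Range (oriented T S R f g s) = Domain (oriented T S R f g (opp s))"
  by (simp only: converse_oriented[symmetric] Domain_converse)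

lemma single_valued_oriented: "single_valued (oriented T S R f g s)"
proof -
  have "inj (case_sum Dom Mid)" "inj (case_sum Mid Cod)"
    by (auto simp: inj_def split: sum.splits)
  moreover have "single_valued {(x, y) \<in> f. variance T S x = s}"
    "single_valued {(x, y) \<in> g. variance S R x = s}"
    using graph_single_valued[OF f] graph_single_valued[OF g] unfolding single_valued_def by blast+
  moreover have "Domain (relabel (case_sum Dom Mid) {(x, y) \<in> f. variance T S x = s}) \<inter>
      Domain (relabel (case_sum Mid Cod) {(x, y) \<in> g. variance S R x = s}) = {}" (is "?F \<inter> ?G = {}")
  proof -
    have False if "u \<in> ?F" "u \<in> ?G" for u
    proof -
      obtain x where x: "u = case_sum Dom Mid x" "variance T S x = s"
        using \<open>u \<in> ?F\<close> by (elim DomainE relabelE) simp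
      obtain y where y: "u = case_sum Mid Cod y" "variance S R y = s"
        using \<open>u \<in> ?G\<close> by (elim DomainE relabelE) simp
      show False
        using x y by (cases x; cases y) (auto simp: variance_def)
    qed
    then show ?thesis by blast
  qed
  ultimately show ?thesis
    unfolding oriented_def by (intro single_valued_Un single_valued_relabel)
qed

lemma finite_oriented: "finite (oriented T S R f g s)"
proof -
  have "finite h" if "graph U V h" for U V h
  proof (rule finite_subset)
    show "h \<subseteq> graph_vars U V \<times> graph_vars U V" using that by (rule graph_sub)
    show "finite (graph_vars U V \<times> graph_vars U V)" by (simp add: graph_vars_def)
  qed
  then have "finite f" "finite g"
    using f g by blast+
  then have "finite {(x, y) \<in> f. variance T S x = s}" "finite {(x, y) \<in> g. variance S R x = s}"
    by (auto elim: finite_subset[rotated])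
  moreover have "relabel h r = map_prod h h ` r" for h :: "nat + nat \<Rightarrow> glued" and r
    by (auto simp: relabel_def)
  ultimately show ?thesis
    by (simp add: oriented_def)
qed

text \<open>
  Together with \<open>Range_oriented\<close> this says that the directed paths start at the outer variables of
  variance \<open>s\<close> and end at those of the opposite variance.
\<close>

lemma Domain_oriented:
  "Domain (oriented T S R f g s) =
    Mid ` {..<nvars S} \<union> outer ` {x \<in> graph_vars T R. variance T R x = s}" (is "?L = ?R")
proof
  have FR: "case_sum Dom Mid x \<in> ?R" if "(x, y) \<in> f" "variance T S x = s" for x y
  proof -
    have "x \<in> graph_vars T S" using graph_sub[OF f] that by auto
    then show ?thesis using that(2)
      by (cases x) (auto simp: graph_vars_def variance_def intro!: image_eqI[of _ _ "Inl _"])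
  qed
  have GR: "case_sum Mid Cod x \<in> ?R" if "(x, y) \<in> g" "variance S R x = s" for x y
  proof -
    have "x \<in> graph_vars S R" using graph_sub[OF g] that by auto
    then show ?thesis using that(2)
      by (cases x) (auto simp: graph_vars_def variance_def intro!: image_eqI[of _ _ "Inr _"])
  qed
  show "?L \<subseteq> ?R"
    unfolding oriented_def relabel_def using FR GR by blast
  have FD: "case_sum Dom Mid x \<in> ?L" if x: "x \<in> graph_vars T S" "variance T S x = s" for x
  proof -
    obtain y where "(x, y) \<in> f" using graph_total[OF f x(1)] by blast
    then have "(case_sum Dom Mid x, case_sum Dom Mid y) \<in> oriented T S R f g s"
      unfolding oriented_def using x(2) by (intro UnI1 relabelI) simp
    then show ?thesis by (rule DomainI)
  qed
  have GD: "case_sum Mid Cod x \<in> ?L" if x: "x \<in> graph_vars S R" "variance S R x = s" for x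
  proof -
    obtain y where "(x, y) \<in> g" using graph_total[OF g x(1)] by blast
    then have "(case_sum Mid Cod x, case_sum Mid Cod y) \<in> oriented T S R f g s"
      unfolding oriented_def using x(2) by (intro UnI2 relabelI) simp
    then show ?thesis by (rule DomainI)
  qed
  have "Mid i \<in> ?L" if "i < nvars S" for i
  proof (cases "vars S ! i = s")
    case True
    then show ?thesis
      using FD[of "Inr i"] that by (simp add: graph_vars_def variance_def InrI)
  next
    case False
    then have "opp (vars S ! i) = s" by (metis neq_opp_iff)
    then show ?thesis
      using GD[of "Inl i"] that by (simp add: graph_vars_def variance_def InlI)
  qed
  moreover have "outer x \<in> ?L" if x: "x \<in> graph_vars T R" "variance T R x = s" for x
  proof (cases x)
    case (Inl i)
    then show ?thesis
      using FD[of "Inl i"] x by (auto simp: graph_vars_def variance_def)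
  next
    case (Inr i)
    then show ?thesis
      using GD[of "Inr i"] x by (auto simp: graph_vars_def variance_def)
  qed
  ultimately show "?R \<subseteq> ?L" by auto
qed

lemma outer_inject [simp]: "outer x = outer y \<longleftrightarrow> x = y"
  by (cases x; cases y) auto

lemma outer_neq_Mid [simp]: "outer x \<noteq> Mid i" "Mid i \<noteq> outer x"
  by (cases x; simp)+

lemma outer_in_Domain_oriented:
  "outer x \<in> Domain (oriented T S R f g s) \<longleftrightarrow> x \<in> graph_vars T R \<and> variance T R x = s"
  by (auto simp: Domain_oriented)

text \<open>
  No directed edge enters an outer variable of variance \<open>s\<close>, so everything connected to it
  is reached along the direction.
\<close>

lemma compose_oriented:
  assumes "x \<in> graph_vars T R" "variance T R x = s"
  shows "(x, y) \<in> compose g f \<longleftrightarrow> x \<noteq> y \<and> (outer x, outer y) \<in> (oriented T S R f g s)\<^sup>*"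
proof -
  let ?D = "oriented T S R f g"
  have "outer x \<notin> Domain (?D (opp s))"
    using assms by (simp add: outer_in_Domain_oriented)
  then have none: "(outer x, outer y) \<in> (?D (opp s))\<^sup>* \<Longrightarrow> x = y"
    by (simp add: Not_Domain_rtrancl)
  have star: "(?D s \<union> ?D (opp s))\<^sup>* = (?D s)\<^sup>* \<union> (?D (opp s))\<^sup>*"
    by (rule rtrancl_Un_converse[of "?D s", unfolded converse_oriented,
          OF single_valued_oriented single_valued_oriented])
  have "(x, y) \<in> compose g f \<longleftrightarrow>
      x \<noteq> y \<and> (outer x, outer y) \<in> (?D s)\<^sup>* \<union> (?D (opp s))\<^sup>*"
    by (simp only: compose_def oriented_Un[of s] star mem_Collect_eq prod.case)
  then show ?thesis
    using none by blast
qed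

lemma compose_opposite:
  assumes "(x, y) \<in> compose g f" "x \<in> graph_vars T R"
  shows "y \<in> graph_vars T R" "variance T R y = opp (variance T R x)"
proof -
  let ?s = "variance T R x"
  note path = compose_oriented[OF assms(2) refl, THEN iffD1, OF assms(1)]
  have "x \<noteq> y" "(outer x, outer y) \<in> (oriented T S R f g ?s)\<^sup>*"
    using path by (rule conjunct1) (use path in \<open>rule conjunct2\<close>)
  then have "outer y \<in> Range (oriented T S R f g ?s)"
    by (intro rtrancl_in_Range[of "outer x"]) simp_all
  then have "outer y \<in> Domain (oriented T S R f g (opp ?s))"
    by (simp only: Range_oriented)
  then show "y \<in> graph_vars T R" "variance T R y = opp ?s"
    by (simp_all add: outer_in_Domain_oriented)
qed

text \<open>
  Existence: the orbit of \<open>x\<close> has to stop, and can do so only at an outer variable.  Uniqueness: the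
  orbit is a single chain, so of two stopping points one would have to precede the other.
\<close>

lemma compose_ex1:
  assumes x: "x \<in> graph_vars T R"
  shows "\<exists>!y. (x, y) \<in> compose g f"
proof -
  let ?s = "variance T R x"
  let ?D = "oriented T S R f g"
  have "outer x \<notin> Range (?D ?s)"
    by (simp add: Range_oriented outer_in_Domain_oriented)
  then obtain v where v: "(outer x, v) \<in> (?D ?s)\<^sup>*" "v \<notin> Domain (?D ?s)"
    using finite_orbit_leaves_Domain[of "?D ?s" "outer x"]
    by (auto simp: converse_oriented finite_oriented single_valued_oriented)
  have "outer x \<in> Domain (?D ?s)"
    using x by (simp add: outer_in_Domain_oriented)
  then have "v \<noteq> outer x" using v by auto
  then have "v \<in> Range (?D ?s)"
    using v(1) rtrancl_in_Range by metis
  then have "v \<in> Domain (?D (opp ?s))"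
    by (simp only: Range_oriented)
  then obtain y where y: "v = outer y"
    using v(2) by (auto simp: Domain_oriented)
  show ?thesis
  proof (rule ex1I[of _ y])
    show "(x, y) \<in> compose g f"
      using v(1) y \<open>v \<noteq> outer x\<close> by (intro compose_oriented[OF x refl, THEN iffD2]) auto
    fix z assume z: "(x, z) \<in> compose g f"
    then have "(outer x, outer z) \<in> (?D ?s)\<^sup>*"
      by (rule compose_oriented[OF x refl, THEN iffD1, THEN conjunct2])
    then have "(outer y, outer z) \<in> (?D ?s)\<^sup>* \<or> (outer z, outer y) \<in> (?D ?s)\<^sup>*"
      using v(1) y single_valued_confluent[OF single_valued_oriented] by auto
    moreover have "outer z \<notin> Domain (?D ?s)"
      using compose_opposite[OF z x] by (simp add: outer_in_Domain_oriented)
    moreover have "outer y \<notin> Domain (?D ?s)"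
      using v(2) y by simp
    ultimately have "outer z = outer y"
      by (auto simp: Not_Domain_rtrancl)
    then show "z = y" by simp
  qed
qed

lemma graph_compose: "graph T R (compose g f)"
proof (rule graphI)
  let ?E = "relabel (case_sum Dom Mid) f \<union> relabel (case_sum Mid Cod) g"
  have "sym (?E\<^sup>*)"
    using f g by (intro sym_rtrancl sym_Un sym_relabel graph_sym)
  then show "sym (compose g f)"
    unfolding compose_def sym_def by blast
  have dom: "x \<in> graph_vars T R" if "(x, y) \<in> compose g f" for x y
  proof -
    from that have "(outer x, outer y) \<in> ?E\<^sup>*" "x \<noteq> y"
      by (auto simp: compose_def)
    then have "outer x \<in> Domain ?E"
      using Not_Domain_rtrancl[of "outer x" ?E "outer y"] by auto
    then show ?thesis
      unfolding oriented_Un[of Plus] Domain_Un_eq Un_iff outer_in_Domain_oriented by blast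
  qed
  show "compose g f \<subseteq> graph_vars T R \<times> graph_vars T R"
    using compose_opposite(1) dom by fast
  show "single_valued (compose g f)"
    using compose_ex1 dom by (blast intro: single_valuedI)
  show "\<exists>y. (x, y) \<in> compose g f" if "x \<in> graph_vars T R" for x
    using compose_ex1[OF that] by blast
  show "variance T R x = opp (variance T R y)" if "(x, y) \<in> compose g f" for x y
    using compose_opposite[OF that dom[OF that]] by simp
qed

end

theorem graph_allowable: "allowable T S f \<Longrightarrow> graph T S f"
  by (induction rule: allowable.induct)
    (auto intro: graph_id graph_c graph_d graph_e graph_tensor graph_hom graph_compose)


section \<open>Labelled shapes\<close>

text \<open>
  A labelled shape is a shape with a label at each occurrence of \<open>1\<close>.
\<close>

datatype 'a lfactor = LOne 'a | LHom "'a lfactor list" "'a lfactor list"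

primrec erase :: "'a lfactor \<Rightarrow> factor" where
  "erase (LOne a) = One"
| "erase (LHom L M) = Hom (map erase L) (map erase M)"

primrec factor_labels :: "'a lfactor \<Rightarrow> 'a list" where
  "factor_labels (LOne a) = [a]"
| "factor_labels (LHom L M) = concat (map factor_labels L) @ concat (map factor_labels M)"

abbreviation shape_of :: "'a lfactor list \<Rightarrow> shape" where
  "shape_of L \<equiv> map erase L"

definition labels :: "'a lfactor list \<Rightarrow> 'a list" where
  "labels L = concat (map factor_labels L)"

lemma labels_append [simp]: "labels (L @ M) = labels L @ labels M"
  and labels_Hom [simp]: "labels [LHom L M] = labels L @ labels M"
  by (simp_all add: labels_def)

lemma length_factor_vars_erase: "length (factor_vars (erase t)) = length (factor_labels t)"
  by (induction t) (simp_all add: length_concat o_def cong: map_cong)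

lemma length_labels [simp]: "length (labels L) = nvars (shape_of L)"
  by (simp add: labels_def vars_def length_concat o_def length_factor_vars_erase)

abbreviation label :: "'a lfactor list \<Rightarrow> 'a lfactor list \<Rightarrow> nat + nat \<Rightarrow> 'a" where
  "label L M \<equiv> case_sum (nth (labels L)) (nth (labels M))"

text \<open>
  Labels need not be distinct, and mates are only required to have equal labels, not
  conversely.  This weak condition is what makes the relation compose; that the labels determine
  the graph is shown separately, for the labels of a tree.
\<close>

definition label_allowable :: "'a lfactor list \<Rightarrow> 'a lfactor list \<Rightarrow> bool" (infix "\<leadsto>" 50) where
  "L \<leadsto> M \<longleftrightarrow> (\<exists>f. allowable (shape_of L) (shape_of M) f \<and>
     (\<forall>(x, y) \<in> f. label L M x = label L M y))"

lemma label_allowableI: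
  assumes "allowable (shape_of L) (shape_of M) f"
    and "\<And>x y. (x, y) \<in> f \<Longrightarrow> label L M x = label L M y"
  shows "L \<leadsto> M"
  using assms by (auto simp: label_allowable_def)

lemma label_allowable_refl: "L \<leadsto> L"
proof (rule label_allowableI)
  show "allowable (shape_of L) (shape_of L) (id_graph (shape_of L))"
    by (rule allowable_id)
qed (auto simp: id_graph_def sym_closure_def)

lemma label_allowable_swap: "L @ M \<leadsto> M @ L"
proof (rule label_allowableI)
  show "allowable (shape_of (L @ M)) (shape_of (M @ L)) (c_graph (shape_of L) (shape_of M))"
    using allowable_c by (simp add: tensor_def)
qed (auto simp: c_graph_def sym_closure_def nth_append)

lemma label_allowable_coeval: "L \<leadsto> [LHom M (L @ M)]"
proof (rule label_allowableI)
  show "allowable (shape_of L) (shape_of [LHom M (L @ M)]) (d_graph (shape_of L) (shape_of M))"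
    using allowable_d by (simp add: tensor_def hom_shape_def)
qed (auto simp: d_graph_def sym_closure_def nth_append)

lemma label_allowable_eval: "LHom L M # L \<leadsto> M"
proof (rule label_allowableI)
  show "allowable (shape_of (LHom L M # L)) (shape_of M) (e_graph (shape_of L) (shape_of M))"
    using allowable_e[of "shape_of L" "shape_of M"] by (simp add: tensor_def hom_shape_def)
  have "labels (LHom L M # L) = labels L @ labels M @ labels L"
    by (simp add: labels_def)
  then show "label (LHom L M # L) M x = label (LHom L M # L) M y"
    if "(x, y) \<in> e_graph (shape_of L) (shape_of M)" for x y
    using that by (auto simp: e_graph_def sym_closure_def nth_append)
qed

text \<open>
  Every edge of the glued graph joins variables with equal labels, hence so does every path.
\<close>

lemma label_allowable_trans [trans]:
  assumes "L \<leadsto> M" "M \<leadsto> N"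
  shows "L \<leadsto> N"
proof -
  obtain f where f: "allowable (shape_of L) (shape_of M) f"
    "\<And>x y. (x, y) \<in> f \<Longrightarrow> label L M x = label L M y"
    using assms(1) by (auto simp: label_allowable_def)
  obtain g where g: "allowable (shape_of M) (shape_of N) g"
    "\<And>x y. (x, y) \<in> g \<Longrightarrow> label M N x = label M N y"
    using assms(2) by (auto simp: label_allowable_def)
  define lab where "lab = case_glued (nth (labels L)) (nth (labels M)) (nth (labels N))"
  have lab: "lab (case_sum Dom Mid x) = label L M x" "lab (case_sum Mid Cod x) = label M N x"
    "lab (outer x) = label L N x" for x
    by (auto simp: lab_def split: sum.splits)
  have "lab u = lab v"
    if "(u, v) \<in> (relabel (case_sum Dom Mid) f \<union> relabel (case_sum Mid Cod) g)\<^sup>*" for u v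
    using that
  proof (induction rule: rtrancl_induct)
    case (step v w)
    then show ?case using f(2) g(2) by (auto simp: relabel_def lab)
  qed simp
  then have "label L N x = label L N y" if "(x, y) \<in> compose g f" for x y
    using that by (auto simp: compose_def simp flip: lab(3))
  then show ?thesis
    using allowable_comp[OF f(1) g(1)] by (rule label_allowableI[rotated])
qed

lemma labels_agree_relabel_Un:
  assumes sub: "f \<subseteq> V \<times> V"
    and p: "\<And>x. x \<in> V \<Longrightarrow> lab (p x) = lab_f x" and q: "\<And>x. lab (q x) = lab_g x"
    and f: "\<And>x y. (x, y) \<in> f \<Longrightarrow> lab_f x = lab_f y" and g: "\<And>x y. (x, y) \<in> g \<Longrightarrow> lab_g x = lab_g y"
    and mem: "(x, y) \<in> relabel p f \<union> relabel q g"
  shows "lab x = lab y"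
  using mem
proof
  assume "(x, y) \<in> relabel p f"
  then obtain a b where ab: "x = p a" "y = p b" "(a, b) \<in> f" by (rule relabelE)
  moreover have "a \<in> V" "b \<in> V" using sub ab(3) by auto
  ultimately show ?thesis using p f[OF ab(3)] by simp
next
  assume "(x, y) \<in> relabel q g"
  then obtain a b where ab: "x = q a" "y = q b" "(a, b) \<in> g" by (rule relabelE)
  then show ?thesis using q g[OF ab(3)] by simp
qed

lemma label_allowable_tensor:
  assumes "L \<leadsto> L'" "M \<leadsto> M'"
  shows "L @ M \<leadsto> L' @ M'"
proof -
  obtain f where f: "allowable (shape_of L) (shape_of L') f"
    "\<And>x y. (x, y) \<in> f \<Longrightarrow> label L L' x = label L L' y"
    using assms(1) by (auto simp: label_allowable_def)
  obtain g where g: "allowable (shape_of M) (shape_of M') g"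
    "\<And>x y. (x, y) \<in> g \<Longrightarrow> label M M' x = label M M' y"
    using assms(2) by (auto simp: label_allowable_def)
  have "label (L @ M) (L' @ M') x = label (L @ M) (L' @ M') y"
    if "(x, y) \<in> tensor_graph (shape_of L) (shape_of L') f g" for x y
  proof (rule labels_agree_relabel_Un[where lab = "label (L @ M) (L' @ M')" and p = "\<lambda>x. x"
        and q = "map_sum ((+) (nvars (shape_of L))) ((+) (nvars (shape_of L')))",
        OF graph_sub[OF graph_allowable[OF f(1)]] _ _ f(2) g(2)])
    show "(x, y) \<in> relabel (\<lambda>x. x) f \<union>
        relabel (map_sum ((+) (nvars (shape_of L))) ((+) (nvars (shape_of L')))) g"
      using that by (simp add: tensor_graph_def relabel_id)
    show "label (L @ M) (L' @ M') x = label L L' x"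
      if "x \<in> graph_vars (shape_of L) (shape_of L')" for x
      using that by (auto simp: graph_vars_def nth_append)
    show "label (L @ M) (L' @ M')
        (map_sum ((+) (nvars (shape_of L))) ((+) (nvars (shape_of L'))) x) = label M M' x" for x
      by (cases x) (auto simp: nth_append)
  qed
  moreover have "allowable (shape_of (L @ M)) (shape_of (L' @ M'))
      (tensor_graph (shape_of L) (shape_of L') f g)"
    using allowable_tensor[OF f(1) g(1)] by (simp add: tensor_def)
  ultimately show ?thesis by (rule label_allowableI[rotated])
qed

lemma label_allowable_hom:
  assumes "L \<leadsto> L'" "M \<leadsto> M'"
  shows "[LHom L' M] \<leadsto> [LHom L M']"
proof -
  obtain f where f: "allowable (shape_of L) (shape_of L') f"
    "\<And>x y. (x, y) \<in> f \<Longrightarrow> label L L' x = label L L' y"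
    using assms(1) by (auto simp: label_allowable_def)
  obtain g where g: "allowable (shape_of M) (shape_of M') g"
    "\<And>x y. (x, y) \<in> g \<Longrightarrow> label M M' x = label M M' y"
    using assms(2) by (auto simp: label_allowable_def)
  have "label [LHom L' M] [LHom L M'] x = label [LHom L' M] [LHom L M'] y"
    if "(x, y) \<in> hom_graph (shape_of L) (shape_of L') f g" for x y
  proof (rule labels_agree_relabel_Un[where lab = "label [LHom L' M] [LHom L M']"
        and p = "case_sum Inr Inl" and q = "map_sum ((+) (nvars (shape_of L'))) ((+) (nvars (shape_of L)))",
        OF graph_sub[OF graph_allowable[OF f(1)]] _ _ f(2) g(2)])
    show "(x, y) \<in> relabel (case_sum Inr Inl) f \<union>
        relabel (map_sum ((+) (nvars (shape_of L'))) ((+) (nvars (shape_of L)))) g"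
      using that by (simp add: hom_graph_def)
    show "label [LHom L' M] [LHom L M'] (case_sum Inr Inl x) = label L L' x"
      if "x \<in> graph_vars (shape_of L) (shape_of L')" for x
      using that by (auto simp: graph_vars_def nth_append)
    show "label [LHom L' M] [LHom L M']
        (map_sum ((+) (nvars (shape_of L'))) ((+) (nvars (shape_of L))) x) = label M M' x" for x
      by (cases x) (auto simp: nth_append)
  qed
  moreover have "allowable (shape_of [LHom L' M]) (shape_of [LHom L M'])
      (hom_graph (shape_of L) (shape_of L') f g)"
    using allowable_hom[OF f(1) g(1)] by (simp add: hom_shape_def)
  ultimately show ?thesis by (rule label_allowableI[rotated])
qed

text \<open>
  Every permutation of tensor factors is allowable: each factor in turn is carried to its place by a
  symmetry.
\<close>

lemma label_allowable_mset:
  assumes "mset L = mset M"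
  shows "L \<leadsto> M"
  using assms
proof (induction L arbitrary: M)
  case Nil
  then show ?case by (simp add: label_allowable_refl)
next
  case (Cons t L)
  then have "t \<in> set M" by (metis list.set_intros(1) set_mset_mset)
  then obtain A B where M: "M = A @ t # B" by (meson split_list)
  with Cons have "L \<leadsto> A @ B" by simp
  then have "[t] @ L \<leadsto> [t] @ A @ B"
    by (intro label_allowable_tensor label_allowable_refl)
  moreover have "([t] @ A) @ B \<leadsto> (A @ [t]) @ B"
    by (intro label_allowable_tensor label_allowable_refl label_allowable_swap)
  ultimately show ?case
    using label_allowable_trans by (simp add: M)
qed

lemma label_allowable_concat:
  assumes "\<And>j. j \<in> set js \<Longrightarrow> A j \<leadsto> B j"
  shows "concat (map A js) \<leadsto> concat (map B js)"
  using assms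
  by (induction js) (simp_all add: label_allowable_refl label_allowable_tensor)

text \<open>
  Transposition, as \<open>L \<leadsto> [M, L \<otimes> M] \<leadsto> [M, N]\<close>.
\<close>

lemma label_allowable_curry:
  assumes "L @ M \<leadsto> N"
  shows "L \<leadsto> [LHom M N]"
  using label_allowable_coeval label_allowable_hom[OF label_allowable_refl assms]
  by (rule label_allowable_trans)


section \<open>Edges of a planar tree\<close>

lemma graft_addrs_alt:
  "graft_addrs pss = concat (map (\<lambda>j. map ((#) j) (pss ! j)) [0..<length pss])"
  unfolding graft_addrs_def enumerate_eq_zip
  by (rule arg_cong[of _ _ concat]) (auto intro: nth_equalityI)

lemma set_graft_addrs:
  "set (graft_addrs pss) = {j # p | j p. j < length pss \<and> p \<in> set (pss ! j)}"
  by (auto simp: graft_addrs_alt)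

lemma distinct_graft_addrs:
  assumes "\<And>ps. ps \<in> set pss \<Longrightarrow> distinct ps"
  shows "distinct (graft_addrs pss)"
proof -
  have "distinct (concat (map (\<lambda>j. map ((#) j) (pss ! j)) js))"
    if "distinct js" "set js \<subseteq> {..<length pss}" for js
    using that assms by (induction js) (auto simp: distinct_map)
  then show ?thesis by (simp add: graft_addrs_alt lessThan_atLeast0)
qed

lemma distinct_nodes: "distinct (nodes t)"
  by (induction t) (auto simp: set_graft_addrs intro!: distinct_graft_addrs)

lemma distinct_leaves: "distinct (leaves t)"
  by (induction t) (auto intro!: distinct_graft_addrs)

lemma Nil_in_leaves: "[] \<in> set (leaves t) \<longleftrightarrow> t = Null"
  by (cases t) (auto simp: set_graft_addrs)

lemma nodes_leaves_disjoint: "q \<in> set (nodes t) \<Longrightarrow> q \<notin> set (leaves t)"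
proof (induction t arbitrary: q)
  case (Node ts)
  then show ?case by (fastforce simp: set_graft_addrs)
qed simp

lemma map_graft_addrs:
  "map h (graft_addrs (map F ts)) =
    concat (map (\<lambda>j. map (\<lambda>p. h (j # p)) (F (ts ! j))) [0..<length ts])"
  unfolding graft_addrs_alt map_concat by (auto intro!: arg_cong[of _ _ concat])

lemma sum_list_concat: "sum_list (concat xss) = sum_list (map sum_list xss)"
  by (induction xss) auto

text \<open>
  Both sides count the edges of the tree: each is a leaf or the output of a node, and each is an
  input of a node or the root.
\<close>

lemma length_leaves_nodes:
  "length (leaves t) + length (nodes t) = sum_list (map (num_inputs t) (nodes t)) + 1"
proof (induction t)
  case (Node ts)
  have len: "length (graft_addrs (map F ts)) = (\<Sum>j<length ts. length (F (ts ! j)))"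
    for F :: "ptree \<Rightarrow> nat list list"
    by (simp add: graft_addrs_alt length_concat o_def interv_sum_list_conv_sum_set_nat
        lessThan_atLeast0)
  have "sum_list (map (num_inputs (Node ts)) (nodes (Node ts))) =
      length ts + (\<Sum>j<length ts. sum_list (map (num_inputs (ts ! j)) (nodes (ts ! j))))"
    by (simp add: map_graft_addrs sum_list_concat o_def interv_sum_list_conv_sum_set_nat
        lessThan_atLeast0)
  also have "\<dots> = (\<Sum>j<length ts. sum_list (map (num_inputs (ts ! j)) (nodes (ts ! j))) + 1)"
    by (simp only: sum.distrib) simp
  also have "\<dots> = (\<Sum>j<length ts. length (leaves (ts ! j)) + length (nodes (ts ! j)))"
    using Node by (intro sum.cong) auto
  finally show ?case
    by (simp add: len sum.distrib)
qed simp

text \<open>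
  The shape \<open>X n\<close> of a node at address \<open>q\<close>, with each variable labelled by the edge that it stands
  for.  The naming \<open>h\<close> of edges is arbitrary, so that a subtree, whose addresses lack the leading
  input number, can be treated inside the whole tree.
\<close>

definition node_factor :: "(nat list \<Rightarrow> 'a) \<Rightarrow> nat list \<Rightarrow> nat \<Rightarrow> 'a lfactor" where
  "node_factor h q n = LHom (map (\<lambda>j. LOne (h (q @ [j]))) [0..<n]) [LOne (h q)]"

lemma mset_concat_append:
  "mset (concat (map (\<lambda>j. A j @ B j) js)) = mset (concat (map A js) @ concat (map B js))"
  by (induction js) auto

text \<open>
  The induction regroups nodes and leaves by the subtrees of the root node, replaces each
  subtree by its root edge, and evaluates the root node on these edges, which are its inputs.
\<close>

lemma label_allowable_tree:
  "map (\<lambda>q. node_factor h q (num_inputs t q)) (nodes t) @ map (\<lambda>q. LOne (h q)) (leaves t)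
    \<leadsto> [LOne (h [])]"
proof (induction t arbitrary: h)
  case Null
  then show ?case by (simp add: label_allowable_refl)
next
  case (Node ts)
  define A where "A = (\<lambda>j. map (\<lambda>q. node_factor h (j # q) (num_inputs (ts ! j) q)) (nodes (ts ! j)))"
  define B where "B = (\<lambda>j. map (\<lambda>q. LOne (h (j # q))) (leaves (ts ! j)))"
  let ?root = "node_factor h [] (length ts)"
  have "map (\<lambda>q. node_factor h q (num_inputs (Node ts) q)) (nodes (Node ts)) =
      ?root # concat (map A [0..<length ts])"
    by (simp add: map_graft_addrs A_def)
  moreover have "map (\<lambda>q. LOne (h q)) (leaves (Node ts)) = concat (map B [0..<length ts])"
    by (simp add: map_graft_addrs B_def)
  ultimately have "map (\<lambda>q. node_factor h q (num_inputs (Node ts) q)) (nodes (Node ts)) @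
      map (\<lambda>q. LOne (h q)) (leaves (Node ts)) \<leadsto> [?root] @ concat (map (\<lambda>j. A j @ B j) [0..<length ts])"
    using mset_concat_append[of A B] by (intro label_allowable_mset) simp
  also have "\<dots> \<leadsto> [?root] @ concat (map (\<lambda>j. [LOne (h [j])]) [0..<length ts])"
  proof (intro label_allowable_tensor label_allowable_refl label_allowable_concat)
    fix j assume "j \<in> set [0..<length ts]"
    then show "A j @ B j \<leadsto> [LOne (h [j])]"
      using Node[of "ts ! j" "\<lambda>q. h (j # q)"] by (simp add: A_def B_def node_factor_def)
  qed
  also have "\<dots> = LHom (map (\<lambda>j. LOne (h [j])) [0..<length ts]) [LOne (h [])]
      # map (\<lambda>j. LOne (h [j])) [0..<length ts]"
    by (simp add: node_factor_def)
  also have "\<dots> \<leadsto> [LOne (h [])]"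
    by (rule label_allowable_eval)
  finally show ?case .
qed


section \<open>The graph of a tree is allowable\<close>

lemma nth_concat_blocks:
  fixes F :: "nat \<Rightarrow> 'a list"
  assumes "i < k" "j < length (F i)"
  shows "concat (map F [0..<k]) ! ((\<Sum>r<i. length (F r)) + j) = F i ! j"
    and "(\<Sum>r<i. length (F r)) + j < (\<Sum>r<k. length (F r))"
proof -
  have len: "length (concat (map F [0..<n])) = (\<Sum>r<n. length (F r))" for n
    by (simp add: length_concat o_def interv_sum_list_conv_sum_set_nat lessThan_atLeast0)
  have bound: "(\<Sum>r<i. length (F r)) + j < (\<Sum>r<n. length (F r))" if "i < n" for n
  proof -
    have "(\<Sum>r<i. length (F r)) + j < (\<Sum>r<Suc i. length (F r))" using assms by simp
    also have "\<dots> \<le> (\<Sum>r<n. length (F r))" using that by (intro sum_mono2) auto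
    finally show ?thesis .
  qed
  show "(\<Sum>r<i. length (F r)) + j < (\<Sum>r<k. length (F r))" using bound assms by simp
  show "concat (map F [0..<k]) ! ((\<Sum>r<i. length (F r)) + j) = F i ! j"
    using assms(1)
  proof (induction k)
    case (Suc k)
    then show ?case
      using bound[of k] by (cases "i = k") (simp_all add: nth_append len)
  qed simp
qed

lemma block_position:
  fixes m :: "nat \<Rightarrow> nat"
  assumes "n < (\<Sum>r<k. m r)"
  obtains i j where "i < k" "j < m i" "n = (\<Sum>r<i. m r) + j"
  using assms
proof (induction k arbitrary: thesis)
  case (Suc k)
  show ?case
  proof (cases "n < (\<Sum>r<k. m r)")
    case True
    then show ?thesis using Suc.IH Suc.prems(1) by (metis less_SucI)
  next
    case False
    then show ?thesis using Suc.prems(2)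
      by (intro Suc.prems(1)[of k "n - (\<Sum>r<k. m r)"]) auto
  qed
qed simp

lemma concat_map_singleton: "concat (map (\<lambda>x. [f x]) xs) = map f xs"
  by (induction xs) auto

lemma factor_labels_node_factor:
  "factor_labels (node_factor h q n) = map (\<lambda>j. h (q @ [j])) [0..<n] @ [h q]"
  by (simp add: node_factor_def o_def concat_map_singleton)

lemma erase_node_factor: "erase (node_factor h q n) = Hom (replicate n One) [One]"
  by (simp add: node_factor_def o_def map_replicate_const)

lemma tensor_list_concat: "tensor_list Ss = concat Ss"
  by (induction Ss) (simp_all add: tensor_list_def tensor_def unit_shape_def)

lemma X_eq: "X n = [Hom (replicate n One) [One]]"
proof -
  have "concat (replicate n [One]) = replicate n One" by (induction n) simp_all
  then show ?thesis by (simp add: X_def hom_shape_def one_shape_def tensor_list_concat)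
qed

lemma vars_X: "vars (X n) = replicate n Minus @ [Plus]"
proof -
  have "concat (replicate n [Plus]) = replicate n Plus" by (induction n) simp_all
  then show ?thesis by (simp add: X_eq vars_def)
qed

text \<open>
  The domain and the codomain of \<open>\<xi>\<^sub>T\<close>, labelled by the edges of the tree.
\<close>

definition tree_dom :: "ptree \<Rightarrow> (nat list \<Rightarrow> nat) \<Rightarrow> nat list lfactor list" where
  "tree_dom T \<tau> =
     map (\<lambda>i. node_factor (\<lambda>q. q) (nth_node T \<tau> i) (node_inputs T \<tau> i)) [0..<length (nodes T)]"

definition tree_cod :: "ptree \<Rightarrow> (nat \<Rightarrow> nat) \<Rightarrow> nat list lfactor list" where
  "tree_cod T \<rho> = [LHom (map (\<lambda>p. LOne (nth_leaf T \<rho> p)) [0..<length (leaves T)]) [LOne []]]"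

lemma shape_of_tree_dom:
  "shape_of (tree_dom T \<tau>) = tensor_list (map (\<lambda>i. X (node_inputs T \<tau> i)) [0..<length (nodes T)])"
  by (simp add: tree_dom_def tensor_list_concat X_eq erase_node_factor concat_map_singleton)

lemma shape_of_tree_cod: "shape_of (tree_cod T \<rho>) = X (length (leaves T))"
  by (simp add: tree_cod_def X_eq o_def map_replicate_const)

lemma mset_map_bij_betw:
  assumes "bij_betw F {..<length xs} (set xs)" "distinct xs"
  shows "mset (map F [0..<length xs]) = mset xs"
proof -
  have "distinct (map F [0..<length xs])" "set (map F [0..<length xs]) = set xs"
    using assms(1) by (auto simp: distinct_map bij_betw_def lessThan_atLeast0)
  then show ?thesis using assms(2) set_eq_iff_mset_eq_distinct by blast
qed

context
  fixes T :: ptree and \<rho> :: "nat \<Rightarrow> nat" and \<tau> :: "nat list \<Rightarrow> nat"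
  assumes combed: "combed_tree T \<rho> \<tau>"
begin

abbreviation (input) "k \<equiv> length (nodes T)"
abbreviation (input) "l \<equiv> length (leaves T)"
abbreviation (input) "N \<equiv> nth_node T \<tau>"
abbreviation (input) "m \<equiv> node_inputs T \<tau>"
abbreviation (input) "src \<equiv> shape_of (tree_dom T \<tau>)"
abbreviation (input) "tgt \<equiv> shape_of (tree_cod T \<rho>)"
abbreviation (input) "edge \<equiv> label (tree_dom T \<tau>) (tree_cod T \<rho>)"

lemma bij_betw_nth_node: "bij_betw N {..<k} (set (nodes T))"
  using combed bij_betw_inv_into unfolding combed_tree_def nth_node_def by fastforce

lemma bij_betw_nth_leaf: "bij_betw (nth_leaf T \<rho>) {..<l} (set (leaves T))"
proof -
  have "bij_betw (inv \<rho>) {..<l} {..<l}"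
    using combed by (intro permutes_imp_bij permutes_inv) (simp add: combed_tree_def)
  moreover have "bij_betw ((!) (leaves T)) {..<l} (set (leaves T))"
    by (intro bij_betw_nth distinct_leaves) auto
  ultimately show ?thesis
    using bij_betw_trans by (fastforce simp: nth_leaf_def[abs_def] o_def)
qed

lemma label_allowable_tree_dom_cod: "tree_dom T \<tau> \<leadsto> tree_cod T \<rho>"
  unfolding tree_cod_def
proof (rule label_allowable_curry)
  have "mset (tree_dom T \<tau>) =
      image_mset (\<lambda>q. node_factor (\<lambda>q. q) q (num_inputs T q)) (mset (map N [0..<k]))"
    by (simp add: tree_dom_def node_inputs_def image_mset.compositionality o_def)
  moreover have "mset (map (\<lambda>p. LOne (nth_leaf T \<rho> p)) [0..<l]) =
      image_mset LOne (mset (map (nth_leaf T \<rho>) [0..<l]))"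
    by (simp add: image_mset.compositionality o_def)
  ultimately have "tree_dom T \<tau> @ map (\<lambda>p. LOne (nth_leaf T \<rho> p)) [0..<l] \<leadsto>
      map (\<lambda>q. node_factor (\<lambda>q. q) q (num_inputs T q)) (nodes T) @ map LOne (leaves T)"
    using mset_map_bij_betw[OF bij_betw_nth_node distinct_nodes]
      mset_map_bij_betw[OF bij_betw_nth_leaf distinct_leaves]
    by (intro label_allowable_mset) simp
  also have "\<dots> \<leadsto> [LOne []]"
    by (rule label_allowable_tree)
  finally show "tree_dom T \<tau> @ map (\<lambda>p. LOne (nth_leaf T \<rho> p)) [0..<l] \<leadsto> [LOne []]" .
qed

lemma labels_tree_dom:
  "labels (tree_dom T \<tau>) = concat (map (\<lambda>i. map (\<lambda>j. N i @ [j]) [0..<m i] @ [N i]) [0..<k])"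
  by (simp add: labels_def tree_dom_def o_def factor_labels_node_factor)

lemma labels_tree_cod: "labels (tree_cod T \<rho>) = map (nth_leaf T \<rho>) [0..<l] @ [[]]"
  by (simp add: tree_cod_def) (simp add: labels_def o_def concat_map_singleton)

lemma vars_src: "vars src = concat (map (\<lambda>i. replicate (m i) Minus @ [Plus]) [0..<k])"
proof -
  have "vars (concat Ss) = concat (map vars Ss)" for Ss
    by (induction Ss) (simp_all add: vars_def)
  then show ?thesis
    by (simp add: shape_of_tree_dom tensor_list_concat vars_X o_def)
qed

lemma vars_tgt: "vars tgt = replicate l Minus @ [Plus]"
  by (simp add: shape_of_tree_cod vars_X)

lemma edge_A_in: "i < k \<Longrightarrow> j < m i \<Longrightarrow> edge (A_in m i j) = N i @ [j]"
  using nth_concat_blocks(1)[of i k j "\<lambda>i. map (\<lambda>j. N i @ [j]) [0..<m i] @ [N i]"]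
  by (simp add: labels_tree_dom A_in_def nth_append)

lemma edge_A_out: "i < k \<Longrightarrow> edge (A_out m i) = N i"
  using nth_concat_blocks(1)[of i k "m i" "\<lambda>i. map (\<lambda>j. N i @ [j]) [0..<m i] @ [N i]"]
  by (simp add: labels_tree_dom A_out_def nth_append)

lemma edge_B_in: "p < l \<Longrightarrow> edge (B_in p) = nth_leaf T \<rho> p"
  by (simp add: labels_tree_cod B_in_def nth_append)

lemma edge_B_out: "edge (B_out l) = []"
  by (simp add: labels_tree_cod B_out_def nth_append)

lemma variance_A_in: "i < k \<Longrightarrow> j < m i \<Longrightarrow> variance src tgt (A_in m i j) = Plus"
  using nth_concat_blocks(1)[of i k j "\<lambda>i. replicate (m i) Minus @ [Plus]"]
  by (simp add: vars_src variance_def A_in_def nth_append)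

lemma variance_A_out: "i < k \<Longrightarrow> variance src tgt (A_out m i) = Minus"
  using nth_concat_blocks(1)[of i k "m i" "\<lambda>i. replicate (m i) Minus @ [Plus]"]
  by (simp add: vars_src variance_def A_out_def nth_append)

lemma variance_B_in: "p < l \<Longrightarrow> variance src tgt (B_in p) = Minus"
  by (simp add: vars_tgt variance_def B_in_def nth_append)

lemma variance_B_out: "variance src tgt (B_out l) = Plus"
  by (simp add: vars_tgt variance_def B_out_def nth_append)

lemma nvars_src: "nvars src = (\<Sum>r<k. m r + 1)"
  by (simp add: vars_src length_concat o_def interv_sum_list_conv_sum_set_nat lessThan_atLeast0)

lemma tree_var_cases:
  assumes "x \<in> graph_vars src tgt"
  obtains (A_in) i j where "i < k" "j < m i" "x = A_in m i j"
  | (A_out) i where "i < k" "x = A_out m i"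
  | (B_in) p where "p < l" "x = B_in p"
  | (B_out) "x = B_out l"
proof (cases x)
  case (Inl n)
  then have "n < (\<Sum>r<k. m r + 1)"
    using assms by (auto simp: graph_vars_def nvars_src)
  then obtain i j where ij: "i < k" "j < m i + 1" "n = (\<Sum>r<i. m r + 1) + j"
    by (rule block_position)
  then show ?thesis
    using that(1)[of i j] that(2)[of i] Inl by (cases "j < m i") (auto simp: A_in_def A_out_def less_Suc_eq)
next
  case (Inr n)
  then have "n < l + 1"
    using assms by (auto simp: graph_vars_def vars_tgt)
  then show ?thesis
    using that(3)[of n] that(4) Inr by (cases "n < l") (auto simp: B_in_def B_out_def less_Suc_eq)
qed

lemma
  shows A_in_in_vars: "i < k \<Longrightarrow> j < m i \<Longrightarrow> A_in m i j \<in> graph_vars src tgt"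
    and A_out_in_vars: "i < k \<Longrightarrow> A_out m i \<in> graph_vars src tgt"
    and B_in_in_vars: "p < l \<Longrightarrow> B_in p \<in> graph_vars src tgt"
    and B_out_in_vars: "B_out l \<in> graph_vars src tgt"
  using nth_concat_blocks(2)[of i k j "\<lambda>i. replicate (m i) Minus @ [Plus]"]
    nth_concat_blocks(2)[of i k "m i" "\<lambda>i. replicate (m i) Minus @ [Plus]"]
  by (auto simp add: graph_vars_def A_in_def A_out_def B_in_def B_out_def nvars_src vars_tgt)

lemma nth_node_inject: "i < k \<Longrightarrow> r < k \<Longrightarrow> N i = N r \<longleftrightarrow> i = r"
  using bij_betw_nth_node by (auto simp: bij_betw_def inj_on_def)

lemma nth_leaf_inject: "p < l \<Longrightarrow> q < l \<Longrightarrow> nth_leaf T \<rho> p = nth_leaf T \<rho> q \<longleftrightarrow> p = q"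
  using bij_betw_nth_leaf by (auto simp: bij_betw_def inj_on_def)

lemma nth_node_neq_nth_leaf: "i < k \<Longrightarrow> p < l \<Longrightarrow> N i \<noteq> nth_leaf T \<rho> p"
  using bij_betw_apply[OF bij_betw_nth_node, of i] bij_betw_apply[OF bij_betw_nth_leaf, of p]
    nodes_leaves_disjoint by auto

lemma nth_leaf_Nil:
  assumes "p < l" "nth_leaf T \<rho> p = []"
  shows "T = Null" "p = 0"
proof -
  show "T = Null"
    using bij_betw_apply[OF bij_betw_nth_leaf, of p] assms by (simp add: Nil_in_leaves)
  then show "p = 0" using assms by simp
qed

text \<open>
  Of the variables carrying an edge, the one of variance \<open>Plus\<close>, \<open>A\<^sub>i\<^sub>j\<close> or \<open>B\<close>, stands for its lower
  end, where it is an input of a node or the root of the tree; the one of variance \<open>Minus\<close>, \<open>A\<^sub>r\<close> or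
  \<open>B\<^sub>p\<close>, stands for its upper end, where it is the output of a node or a leaf.
\<close>

lemma edge_variance_inject:
  assumes "x \<in> graph_vars src tgt" "y \<in> graph_vars src tgt"
    and "edge x = edge y" "variance src tgt x = variance src tgt y"
  shows "x = y"
  using assms(1)
proof (cases rule: tree_var_cases)
  case x: (A_in i j)
  from assms(2) show ?thesis
    by (cases rule: tree_var_cases) (use x assms(3,4) in
      \<open>simp_all add: edge_A_in edge_B_out variance_A_in variance_A_out variance_B_in nth_node_inject\<close>)
next
  case x: (A_out i)
  from assms(2) show ?thesis
    by (cases rule: tree_var_cases) (use x assms(3,4) in
      \<open>simp_all add: edge_A_out edge_B_in variance_A_in variance_A_out variance_B_in variance_B_out
        nth_node_inject nth_node_neq_nth_leaf\<close>)
next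
  case x: (B_in p)
  from assms(2) show ?thesis
    by (cases rule: tree_var_cases) (use x assms(3,4) nth_node_neq_nth_leaf[of _ p] in
      \<open>auto simp add: edge_A_out edge_B_in variance_A_in variance_A_out variance_B_in variance_B_out
        nth_leaf_inject\<close>)
next
  case x: B_out
  from assms(2) show ?thesis
    by (cases rule: tree_var_cases) (use x assms(3,4) in
      \<open>simp_all add: edge_A_in edge_B_out variance_B_out variance_A_out variance_B_in\<close>)
qed

lemma xi_sound:
  assumes "(x, y) \<in> xi T \<rho> \<tau>"
  shows "x \<in> graph_vars src tgt \<and> y \<in> graph_vars src tgt \<and> edge x = edge y \<and>
    variance src tgt x = opp (variance src tgt y)" (is "?P x y")
proof -
  let ?r = "{(A_in m i j, A_out m r) | i j r. i < k \<and> j < m i \<and> r < k \<and> N i @ [j] = N r} \<union>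
      {(A_in m i j, B_in p) | i j p. i < k \<and> j < m i \<and> p < l \<and> N i @ [j] = nth_leaf T \<rho> p} \<union>
      {(A_out m r, B_out l) | r. r < k \<and> N r = []} \<union>
      (if T = Null then {(B_in 0, B_out l)} else {})"
  note [simp] = A_in_in_vars A_out_in_vars B_in_in_vars B_out_in_vars
    edge_A_in edge_A_out edge_B_in edge_B_out
    variance_A_in variance_A_out variance_B_in variance_B_out
  have "?P x y" if xy: "(x, y) \<in> ?r" for x y
  proof -
    consider i j r where "i < k" "j < m i" "r < k" "N i @ [j] = N r" "x = A_in m i j" "y = A_out m r"
      | i j p where "i < k" "j < m i" "p < l" "N i @ [j] = nth_leaf T \<rho> p" "x = A_in m i j" "y = B_in p"
      | r where "r < k" "N r = []" "x = A_out m r" "y = B_out l"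
      | "T = Null" "x = B_in 0" "y = B_out l"
      using xy by (auto split: if_splits)
    then show ?thesis
    proof cases
      case 4
      then have "0 < l" "nth_leaf T \<rho> 0 = []"
        using bij_betw_apply[OF bij_betw_nth_leaf, of 0] by simp_all
      then show ?thesis using 4(2,3) by simp
    qed simp_all
  qed
  moreover have "(x, y) \<in> ?r \<or> (y, x) \<in> ?r"
    using assms by (simp only: xi_def Let_def sym_closure_def Un_iff converse_iff)
  ultimately show ?thesis by fastforce
qed

text \<open>
  The four possible combinations of a variable of variance \<open>Plus\<close> and one of variance \<open>Minus\<close>
  are the four clauses of the definition of \<open>xi\<close>.
\<close>

lemma xi_complete:
  assumes "x \<in> graph_vars src tgt" "y \<in> graph_vars src tgt" "edge x = edge y"
    and "variance src tgt x = Plus" "variance src tgt y = Minus"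
  shows "(x, y) \<in> xi T \<rho> \<tau>"
  using assms(1)
proof (cases rule: tree_var_cases)
  case x: (A_in i j)
  from assms(2) show ?thesis
  proof (cases rule: tree_var_cases)
    case (A_out r)
    then have "N i @ [j] = N r" using x assms(3) by (simp add: edge_A_in edge_A_out)
    then show ?thesis using x A_out unfolding xi_def Let_def sym_closure_def by blast
  next
    case (B_in p)
    then have "N i @ [j] = nth_leaf T \<rho> p" using x assms(3) by (simp add: edge_A_in edge_B_in)
    then show ?thesis using x B_in unfolding xi_def Let_def sym_closure_def by blast
  qed (use assms(5) in \<open>simp_all add: variance_A_in variance_B_out\<close>)
next
  case x: B_out
  from assms(2) show ?thesis
  proof (cases rule: tree_var_cases)
    case (A_out r)
    then have "N r = []" using x assms(3) by (simp add: edge_B_out edge_A_out)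
    then show ?thesis using x A_out unfolding xi_def Let_def sym_closure_def by blast
  next
    case (B_in p)
    then have "nth_leaf T \<rho> p = []" using x assms(3) by (simp add: edge_B_out edge_B_in)
    then have "T = Null" "p = 0" using nth_leaf_Nil B_in by blast+
    then show ?thesis using x B_in by (simp add: xi_def Let_def sym_closure_def)
  qed (use assms(5) in \<open>simp_all add: variance_A_in variance_B_out\<close>)
qed (use assms(4) in \<open>simp_all add: variance_A_out variance_B_in\<close>)

text \<open>
  By \<open>xi_complete\<close>, \<open>f\<close> is contained in \<open>\<xi>\<^sub>T\<close>.  Conversely, given a pair of \<open>\<xi>\<^sub>T\<close>, the mate of its
  first variable in \<open>f\<close> has the same edge and the same variance as the second, hence equals it.
\<close>

lemma graph_eq_xi:
  assumes f: "graph src tgt f" and edge: "\<And>x y. (x, y) \<in> f \<Longrightarrow> edge x = edge y"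
  shows "f = xi T \<rho> \<tau>"
proof (intro equalityI subrelI)
  fix x y assume xy: "(x, y) \<in> f"
  then have vars: "x \<in> graph_vars src tgt" "y \<in> graph_vars src tgt"
    using graph_sub[OF f] by auto
  have opposite: "variance src tgt x = opp (variance src tgt y)"
    using graph_opposite[OF f xy] .
  show "(x, y) \<in> xi T \<rho> \<tau>"
  proof (cases "variance src tgt x")
    case Plus
    then have "variance src tgt y = Minus" using opposite by (cases "variance src tgt y") auto
    then show ?thesis using xi_complete[OF vars edge[OF xy]] Plus by simp
  next
    case Minus
    then have "variance src tgt y = Plus" using opposite by (cases "variance src tgt y") auto
    then have "(y, x) \<in> xi T \<rho> \<tau>"
      using xi_complete[OF vars(2,1) edge[OF xy, symmetric]] Minus by simp
    then show ?thesis by (auto simp: xi_def Let_def sym_closure_def)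
  qed
next
  fix x y assume xy: "(x, y) \<in> xi T \<rho> \<tau>"
  then obtain z where z: "(x, z) \<in> f"
    using xi_sound graph_total[OF f] by blast
  then have "z \<in> graph_vars src tgt" using graph_sub[OF f] by auto
  moreover have "edge z = edge y"
    using xi_sound[OF xy] edge[OF z] by simp
  moreover have "variance src tgt z = variance src tgt y"
    using xi_sound[OF xy] graph_opposite[OF f z] by simp
  ultimately have "z = y"
    using edge_variance_inject xi_sound[OF xy] by blast
  then show "(x, y) \<in> f" using z by simp
qed

lemma allowable_xi: "allowable src tgt (xi T \<rho> \<tau>)"
proof -
  obtain f where f: "allowable src tgt f" "\<And>x y. (x, y) \<in> f \<Longrightarrow> edge x = edge y"
    using label_allowable_tree_dom_cod unfolding label_allowable_def by blast
  then have "f = xi T \<rho> \<tau>"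
    by (intro graph_eq_xi graph_allowable)
  then show ?thesis using f(1) by simp
qed

lemma sum_node_inputs: "(\<Sum>i<k. m i) + 1 = l + k"
proof -
  have "(\<Sum>i<k. m i) = sum_list (map (num_inputs T) (nodes T))"
    using sum.reindex_bij_betw[OF bij_betw_nth_node, of "num_inputs T"]
    by (simp add: node_inputs_def sum_list_distinct_conv_sum_set distinct_nodes)
  then show ?thesis using length_leaves_nodes[of T] by simp
qed

end

theorem proposition6p1:
  fixes T :: ptree and \<rho> :: "nat \<Rightarrow> nat" and \<tau> :: "nat list \<Rightarrow> nat"
    and k l :: nat and m :: "nat \<Rightarrow> nat"
  assumes "combed_tree T \<rho> \<tau>"
    and "k = length (nodes T)"
    and "\<And>i. i < k \<Longrightarrow> m i = node_inputs T \<tau> i"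
    and "int l = (\<Sum>i<k. int (m i)) - int k + 1"
  shows "graph (tensor_list (map (\<lambda>i. X (m i)) [0..<k])) (X l) (xi T \<rho> \<tau>) \<and>
    allowable (tensor_list (map (\<lambda>i. X (m i)) [0..<k])) (X l) (xi T \<rho> \<tau>)"
proof -
  \<comment> \<open>the number \<open>l\<close> given by the formula is the number of leaves\<close>
  have "(\<Sum>i<k. m i) + 1 = length (leaves T) + k"
    using sum_node_inputs[OF assms(1)] assms(2,3) by simp
  then have "int (\<Sum>i<k. m i) + 1 = int (length (leaves T)) + int k" by linarith
  then have "l = length (leaves T)" using assms(4) by simp
  then have tgt: "X l = shape_of (tree_cod T \<rho>)" by (simp add: shape_of_tree_cod)
  have src: "tensor_list (map (\<lambda>i. X (m i)) [0..<k]) = shape_of (tree_dom T \<tau>)"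
    using assms(2,3) unfolding shape_of_tree_dom
    by (intro arg_cong[of _ _ tensor_list] map_cong) simp_all
  show ?thesis
    unfolding src tgt using allowable_xi[OF assms(1)] graph_allowable by blast
qed

end
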